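(* Let $x^1,\dots,x^n\in\mathbb{R}^m$ and $d_{ij}=\|x^i-x^j\|_2^2$. Let $\{\Gamma_1,\Gamma_2\}$ be a partition of $[n]$ with, without loss of generality, $|\Gamma_1|\le|\Gamma_2|$. Define $$r_1:=\frac{2|\Gamma_1|}{|\Gamma_1|+|\Gamma_2|},\qquad r_2:=\frac{2|\Gamma_2|}{|\Gamma_1|+|\Gamma_2|},$$ and $$\eta:=\frac{r_2}{2}\Bigg(\Big(1-\frac{r_1}{r_2}\Big)\max_{k\in\Gamma_1}d^{\rm in}_k+\Big(1-\frac{r_2}{r_1}\Big)\min_{k\in\Gamma_2}d^{\rm in}_k+\frac{r_1}{r_2}\cdot\frac{1}{|\Gamma_1|}\sum_{k\in\Gamma_1}d^{\rm in}_k+\frac{r_2}{r_1}\cdot\frac{1}{|\Gamma_2|}\sum_{k\in\Gamma_2}d^{\rm in}_k\Bigg).$$ Suppose that the following inequalities hold strictly: $$\frac{1}{|\Gamma_2|}\sum_{k\in\Gamma_2}\min\{r_2d_{ik}+d^{\rm in}_j,\ r_2d_{jk}+d^{\rm in}_i\}-d_{ij}\ >\ \eta,\qquad\forall\, i<j\in\Gamma_1,$$ and $$\frac{1}{|\Gamma_1|}\sum_{k\in\Gamma_1}\min\{r_1d_{ik}+d^{\rm in}_j,\ r_1d_{jk}+d^{\rm in}_i\}-d_{ij}\ >\ \frac{r_1}{r_2}\eta,\qquad\forall\, i<j\in\Gamma_2.$$ Then $$\bar X=\frac{1}{|\Gamma_1|}\mathbf{1}_{\Gamma_1}\mathbf{1}_{\Gamma_1}^T+\frac{1}{|\Gamma_2|}\mathbf{1}_{\Gamma_2}\mathbf{1}_{\Gamma_2}^T$$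 is the unique optimal solution of the linear program (LP2).
   Context: $[n]:=\{1,\dots,n\}$. A partition $\{\Gamma_1,\Gamma_2\}$ of $[n]$ consists of two non-empty disjoint subsets with union $[n]$. $\mathbf{1}_{\Gamma}\in\mathbb{R}^n$ is the indicator vector of $\Gamma\subseteq[n]$. For $i\in\Gamma_l$, $l\in\{1,2\}$: $d^{\rm in}_i:=\frac{1}{|\Gamma_l|}\sum_{j\in\Gamma_l}d_{ij}$ (the sum includes $j=i$, with $d_{ii}=0$). (LP2) is the linear program in the entries of a symmetric matrix $X\in\mathbb{R}^{n\times n}$ ($X_{ij}=X_{ji}$): minimize $\sum_{i,j\in[n]}d_{ij}X_{ij}$ subject to $\mathrm{Tr}(X)=2$; $\sum_{j=1}^nX_{ij}=1$ for all $i\in[n]$; $X_{ij}+X_{ik}\le X_{ii}+X_{jk}$ for all pairwise distinct $i,j,k\in[n]$ with $j<k$; $X_{ij}\ge0$ for all $1\le i<j\le n$. *)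

theory Defs
  imports "HOL-Analysis.Analysis"
begin

text \<open>
  The index set \<open>[n]\<close> is rendered as a finite linearly ordered type \<open>'n\<close> with \<open>n = CARD('n)\<close>.
\<close>

definition d_in :: "('n \<Rightarrow> 'n \<Rightarrow> real) \<Rightarrow> 'n set \<Rightarrow> 'n \<Rightarrow> real" where
  "d_in d \<Gamma> i = 1 / real (card \<Gamma>) * (\<Sum>j\<in>\<Gamma>. d i j)"

definition ind_vec :: "'n set \<Rightarrow> real ^ 'n" where
  "ind_vec \<Gamma> = (\<chi> i. indicator \<Gamma> i)"

definition outer_prod :: "real ^ 'n \<Rightarrow> real ^ 'm \<Rightarrow> real ^ 'm ^ 'n" where
  "outer_prod u v = (\<chi> i j. u $ i * v $ j)"

definition LP2_feasible :: "real ^ ('n::{finite,linorder}) ^ ('n::{finite,linorder}) \<Rightarrow> bool" where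
  "LP2_feasible X \<longleftrightarrow>
     transpose X = X \<and>
     trace X = 2 \<and>
     (\<forall>i. (\<Sum>j\<in>UNIV. X $ i $ j) = 1) \<and>
     (\<forall>i j k. i \<noteq> j \<and> i \<noteq> k \<and> j < k \<longrightarrow> X $ i $ j + X $ i $ k \<le> X $ i $ i + X $ j $ k) \<and>
     (\<forall>i j. i < j \<longrightarrow> 0 \<le> X $ i $ j)"

definition LP2_objective :: "('n \<Rightarrow> 'n \<Rightarrow> real) \<Rightarrow> real ^ 'n ^ 'n \<Rightarrow> real" where
  "LP2_objective d X = (\<Sum>i\<in>UNIV. \<Sum>j\<in>UNIV. d i j * X $ i $ j)"

definition LP2_optimal ::
    "('n \<Rightarrow> 'n \<Rightarrow> real) \<Rightarrow> real ^ ('n::{finite,linorder}) ^ ('n::{finite,linorder}) \<Rightarrow> bool" where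
  "LP2_optimal d X \<longleftrightarrow> is_arg_min (LP2_objective d) LP2_feasible X"

end

theory Submission
  imports Defs
begin

text \<open>
  The proof is linear programming duality with an explicit dual certificate, followed by
  complementary slackness.

  The triangle inequalities that are tight at the partition matrix include all those for which
  \<open>i\<close>, \<open>j\<close> lie in one cluster and \<open>k\<close> in the other, and these alone are given multipliers. Write
  \<open>p\<close>, \<open>q\<close> for the sizes of \<open>\<Gamma>\<^sub>1\<close>, \<open>\<Gamma>\<^sub>2\<close>. For \<open>i\<close>, \<open>j\<close> in \<open>\<Gamma>\<^sub>1\<close> and \<open>k\<close> in \<open>\<Gamma>\<^sub>2\<close>, the two
  inequalities with \<open>i\<close> and \<open>j\<close> exchanged get multipliers whose difference is
  \<open>r\<^sub>2 / q * (d i k - d j k)\<close> up to a term in \<open>d\<^sup>i\<^sup>n\<close>. Because \<open>r\<^sub>1 / p = r\<^sub>2 / q\<close>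
  and \<open>r\<^sub>1 + r\<^sub>2 = 2\<close>, summing such differences over both clusters reproduces the cost \<open>2 * d i k\<close> of
  every entry between the clusters, and the sums of distances that are left over cancel. Taking the
  smaller of the two numbers as zero level is what brings in the minima of the hypotheses; the
  excess of the averaged minimum over \<open>d i j + \<eta>\<close> is then spread evenly over \<open>k\<close>, which makes all
  multipliers positive.

  Lemma \<open>objective_decomposition\<close> records the outcome: on the feasible set the objective is a constant,
  plus the two weighted sums of triangle slacks, plus a combination of the entries between the
  clusters. The parameter \<open>\<eta>\<close> is the least number for which all coefficients of that combination
  are nonnegative. All three parts vanish at the partition matrix, so it is optimal.

  For another optimal \<open>Y\<close> the weighted sums vanish too, and as the multipliers are positive the
  triangle inequalities considered are all equalities at \<open>Y\<close>. By lemma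
  \<open>tight_triangles_imp_partition_matrix\<close> these equalities determine \<open>Y\<close> up to the cluster-wise values of
  its diagonal and one further constant, which the row sums and the trace fix.
\<close>

section \<open>The dual multipliers\<close>

definition triangle_slack :: "real ^ 'n ^ 'n \<Rightarrow> 'n \<Rightarrow> 'n \<Rightarrow> 'n \<Rightarrow> real" where
  "triangle_slack X i j k = X $ i $ i + X $ j $ k - X $ i $ j - X $ i $ k"

definition pair_min :: "('n \<Rightarrow> 'n \<Rightarrow> real) \<Rightarrow> 'n set \<Rightarrow> real \<Rightarrow> 'n \<Rightarrow> 'n \<Rightarrow> 'n \<Rightarrow> real" where
  "pair_min d A r i j k = min (r * d i k + d_in d A j) (r * d j k + d_in d A i)"

text \<open>
  The hypotheses of the theorem say that these gaps are positive, with \<open>e\<close> equal to \<open>\<eta>\<close> on the first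
  cluster and to \<open>r\<^sub>1 / r\<^sub>2 * \<eta>\<close> on the second.
\<close>

definition pair_gap :: "('n \<Rightarrow> 'n \<Rightarrow> real) \<Rightarrow> 'n set \<Rightarrow> 'n set \<Rightarrow> real \<Rightarrow> real \<Rightarrow> 'n \<Rightarrow> 'n \<Rightarrow> real" where
  "pair_gap d A B r e i j = 1 / real (card B) * (\<Sum>k\<in>B. pair_min d A r i j k) - d i j - e"

text \<open>
  The weight of the triangle inequality at apex \<open>i\<close> with other corners \<open>j\<close> in the same cluster \<open>A\<close> and
  \<open>k\<close> in the opposite cluster \<open>B\<close>. For symmetric \<open>d\<close>, \<open>pair_min\<close> and \<open>pair_gap\<close> are symmetric in \<open>i\<close>,
  \<open>j\<close>, so the multipliers of the two apices \<open>i\<close> and \<open>j\<close> differ only through the first two summands.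
\<close>

definition multiplier ::
    "('n \<Rightarrow> 'n \<Rightarrow> real) \<Rightarrow> 'n set \<Rightarrow> 'n set \<Rightarrow> real \<Rightarrow> real \<Rightarrow> 'n \<Rightarrow> 'n \<Rightarrow> 'n \<Rightarrow> real" where
  "multiplier d A B r e i j k =
     (r * d j k + d_in d A i - pair_min d A r i j k + pair_gap d A B r e i j) / real (card B)"

lemma pair_min_commute: "pair_min d A r i j k = pair_min d A r j i k"
  by (simp add: pair_min_def min.commute)

lemma pair_gap_commute:
  assumes "\<And>i j. d i j = d j i"
  shows "pair_gap d A B r e i j = pair_gap d A B r e j i"
  using assms[of i j] by (simp add: pair_gap_def pair_min_commute[of d A r i j])

lemma multiplier_pos:
  assumes "finite B" "B \<noteq> {}" "pair_gap d A B r e i j > 0"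
  shows "multiplier d A B r e i j k > 0"
proof -
  have "pair_min d A r i j k \<le> r * d j k + d_in d A i"
    by (simp add: pair_min_def)
  with assms show ?thesis
    by (simp add: multiplier_def card_gt_0_iff)
qed

text \<open>
  The minima cancel against their average inside \<open>pair_gap\<close>, so that after summation over \<open>k\<close> only
  linear terms remain.
\<close>

lemma sum_multiplier:
  assumes "finite B" "B \<noteq> {}"
  shows "(\<Sum>k\<in>B. multiplier d A B r e i j k) =
    r / real (card B) * (\<Sum>k\<in>B. d j k) + d_in d A i - d i j - e"
proof -
  have q: "real (card B) \<noteq> 0" using assms by simp
  have "(\<Sum>k\<in>B. multiplier d A B r e i j k) =
     (r * (\<Sum>k\<in>B. d j k) + real (card B) * d_in d A i - (\<Sum>k\<in>B. pair_min d A r i j k)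
       + real (card B) * pair_gap d A B r e i j) / real (card B)"
    by (simp add: multiplier_def sum_divide_distrib[symmetric] sum.distrib sum_subtractf
        sum_distrib_left)
  also have "\<dots> = r / real (card B) * (\<Sum>k\<in>B. d j k) + d_in d A i - d i j - e"
    using q by (simp add: pair_gap_def field_simps)
  finally show ?thesis .
qed

lemma multiplier_swap_diff:
  assumes "\<And>i j. d i j = d j i"
  shows "multiplier d A B r e j i k - multiplier d A B r e i j k =
    r / real (card B) * (d i k - d j k) + (d_in d A j - d_in d A i) / real (card B)"
  unfolding multiplier_def pair_min_commute[of d A r j i] pair_gap_commute[of d A B r e j i, OF assms]
  by (simp add: diff_divide_distrib add_divide_distrib algebra_simps)

section \<open>The objective in terms of slacks\<close>

text \<open>
  The contribution of one cluster \<open>A\<close> to the Lagrangian. Degenerate triangles with \<open>i = j\<close> have slack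
  zero, so the sum may run over all pairs of \<open>A\<close>. Splitting the slack as
  \<open>(X\<^sub>i\<^sub>i - X\<^sub>i\<^sub>j) + (X\<^sub>j\<^sub>k - X\<^sub>i\<^sub>k)\<close>, the first half sees only the multipliers summed over \<open>k\<close>, and the
  second, after exchanging \<open>i\<close> and \<open>j\<close>, only the differences of exchanged multipliers; both are free of
  minima. The row sums trade the entries inside \<open>A\<close> that are weighted by a function of \<open>i\<close> alone for
  entries between \<open>A\<close> and \<open>B\<close>.
\<close>

lemma weighted_slack_sum:
  fixes X :: "real ^ 'n::finite ^ 'n" and d :: "'n \<Rightarrow> 'n \<Rightarrow> real"
  assumes d: "\<And>i j. d i j = d j i"
    and X: "\<And>i j. X $ i $ j = X $ j $ i"
    and row: "\<And>i. (\<Sum>j\<in>A. X $ i $ j) + (\<Sum>k\<in>B. X $ i $ k) = 1"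
    and ne: "A \<noteq> {}" "B \<noteq> {}"
  defines "p \<equiv> real (card A)" and "q \<equiv> real (card B)"
  shows "(\<Sum>i\<in>A. \<Sum>j\<in>A. \<Sum>k\<in>B. multiplier d A B r e i j k * triangle_slack X i j k) =
      (r / q * (\<Sum>i\<in>A. \<Sum>k\<in>B. d i k) - p * e) * (\<Sum>i\<in>A. X $ i $ i)
      + (\<Sum>i\<in>A. \<Sum>j\<in>A. d i j * X $ i $ j)
      - (\<Sum>i\<in>A. r / q * (\<Sum>k\<in>B. d i k) + d_in d A i - e)
      + (\<Sum>i\<in>A. \<Sum>k\<in>B. X $ i $ k *
           (r / q * ((\<Sum>l\<in>B. d i l) - (\<Sum>j\<in>A. d j k) + p * d i k)
            + d_in d A i - e + ((\<Sum>j\<in>A. d_in d A j) - p * d_in d A i) / q))"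
    (is "?L = ?T + ?O - ?K + ?C")
proof -
  let ?m = "multiplier d A B r e"
  define D where "D i = (\<Sum>k\<in>B. d i k)" for i
  define w where "w i = r / q * D i + d_in d A i - e" for i
  have p: "p \<noteq> 0" using ne by (simp add: p_def)
  have dsum: "(\<Sum>j\<in>A. d i j) = p * d_in d A i" for i
    using p by (simp add: d_in_def p_def)
  have row': "(\<Sum>j\<in>A. X $ i $ j) = 1 - (\<Sum>k\<in>B. X $ i $ k)" for i
    using row[of i] by simp
  have ms: "(\<Sum>k\<in>B. ?m i j k) = r / q * D j + d_in d A i - d i j - e" for i j
    using sum_multiplier[of B d A r e i j] ne by (simp add: q_def D_def)
  have "?L = (\<Sum>i\<in>A. \<Sum>j\<in>A. (\<Sum>k\<in>B. ?m i j k) * (X $ i $ i - X $ i $ j))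
      + (\<Sum>i\<in>A. \<Sum>j\<in>A. \<Sum>k\<in>B. ?m i j k * (X $ j $ k - X $ i $ k))"
  proof -
    have "(\<Sum>k\<in>B. ?m i j k * triangle_slack X i j k) =
        (\<Sum>k\<in>B. ?m i j k) * (X $ i $ i - X $ i $ j) + (\<Sum>k\<in>B. ?m i j k * (X $ j $ k - X $ i $ k))"
      for i j
      unfolding sum_distrib_right sum.distrib[symmetric]
      by (rule sum.cong[OF refl]) (simp add: triangle_slack_def algebra_simps)
    then show ?thesis by (simp add: sum.distrib)
  qed
  also have "(\<Sum>i\<in>A. \<Sum>j\<in>A. \<Sum>k\<in>B. ?m i j k * (X $ j $ k - X $ i $ k)) =
      (\<Sum>i\<in>A. \<Sum>j\<in>A. \<Sum>k\<in>B. (?m j i k - ?m i j k) * X $ i $ k)"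
  proof -
    have "(\<Sum>i\<in>A. \<Sum>j\<in>A. \<Sum>k\<in>B. ?m i j k * X $ j $ k) =
        (\<Sum>i\<in>A. \<Sum>j\<in>A. \<Sum>k\<in>B. ?m j i k * X $ i $ k)"
      by (rule sum.swap)
    then show ?thesis
      by (simp add: right_diff_distrib left_diff_distrib sum_subtractf)
  qed
  also have "\<dots> = (\<Sum>i\<in>A. \<Sum>k\<in>B. \<Sum>j\<in>A.
       (r / q * (d i k - d j k) + (d_in d A j - d_in d A i) / q) * X $ i $ k)"
    unfolding multiplier_swap_diff[of d, OF d] q_def
    by (rule sum.cong[OF refl]) (rule sum.swap)
  also have "\<dots> = (\<Sum>i\<in>A. \<Sum>k\<in>B. X $ i $ k *
      (r / q * (p * d i k - (\<Sum>j\<in>A. d j k)) + ((\<Sum>j\<in>A. d_in d A j) - p * d_in d A i) / q))"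
    (is "_ = ?S")
    by (simp add: sum_distrib_right[symmetric] sum.distrib sum_distrib_left[symmetric]
        sum_divide_distrib[symmetric] sum_subtractf p_def mult.commute)
  also have "(\<Sum>i\<in>A. \<Sum>j\<in>A. (\<Sum>k\<in>B. ?m i j k) * (X $ i $ i - X $ i $ j)) =
      (\<Sum>i\<in>A. X $ i $ i * (\<Sum>j\<in>A. r / q * D j + d_in d A i - d i j - e))
      - (\<Sum>i\<in>A. \<Sum>j\<in>A. (r / q * D j + d_in d A i - d i j - e) * X $ i $ j)"
  proof -
    have "(\<Sum>i\<in>A. \<Sum>j\<in>A. L i j * (X $ i $ i - X $ i $ j)) =
      (\<Sum>i\<in>A. X $ i $ i * (\<Sum>j\<in>A. L i j)) - (\<Sum>i\<in>A. \<Sum>j\<in>A. L i j * X $ i $ j)" for L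
      by (simp add: right_diff_distrib sum_subtractf sum_distrib_right mult.commute)
    then show ?thesis by (simp only: ms)
  qed
  also have "(\<Sum>i\<in>A. X $ i $ i * (\<Sum>j\<in>A. r / q * D j + d_in d A i - d i j - e)) = ?T"
  proof -
    have "(\<Sum>j\<in>A. r / q * D j + d_in d A i - d i j - e) = r / q * (\<Sum>j\<in>A. D j) - p * e" for i
      by (simp add: sum.distrib sum_subtractf sum_distrib_left[symmetric]
          sum_divide_distrib[symmetric] dsum p_def[symmetric])
    then show ?thesis
      by (simp add: sum_distrib_right[symmetric] D_def mult.commute)
  qed
  also have "(\<Sum>i\<in>A. \<Sum>j\<in>A. (r / q * D j + d_in d A i - d i j - e) * X $ i $ j) =
      (\<Sum>i\<in>A. w i * (\<Sum>j\<in>A. X $ i $ j)) - ?O"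
  proof -
    have "(\<Sum>i\<in>A. \<Sum>j\<in>A. r / q * D j * X $ i $ j) = (\<Sum>i\<in>A. \<Sum>j\<in>A. r / q * D i * X $ i $ j)"
      by (subst sum.swap) (simp add: X)
    then show ?thesis
      by (simp add: w_def sum_distrib_left left_diff_distrib distrib_right sum.distrib sum_subtractf)
  qed
  also have "(\<Sum>i\<in>A. w i * (\<Sum>j\<in>A. X $ i $ j)) = ?K - (\<Sum>i\<in>A. \<Sum>k\<in>B. X $ i $ k * w i)"
  proof -
    have "?K = (\<Sum>i\<in>A. w i)" by (simp only: w_def D_def)
    then show ?thesis
      by (simp add: row' right_diff_distrib sum_subtractf sum_distrib_left mult.commute)
  qed
  also have "?T - (?K - (\<Sum>i\<in>A. \<Sum>k\<in>B. X $ i $ k * w i) - ?O) + ?S =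
     ?T + ?O - ?K + ((\<Sum>i\<in>A. \<Sum>k\<in>B. X $ i $ k * w i) + ?S)"
    by simp
  also have "(\<Sum>i\<in>A. \<Sum>k\<in>B. X $ i $ k * w i) + ?S = ?C"
    unfolding sum.distrib[symmetric] distrib_left[symmetric]
    by (intro sum.cong refl arg_cong2[where f = "(*)"]) (simp add: w_def D_def algebra_simps)
  finally show ?thesis .
qed

lemma sum_partition:
  fixes f :: "'n::finite \<Rightarrow> real"
  assumes "A \<inter> B = {}" "A \<union> B = UNIV"
  shows "(\<Sum>i\<in>UNIV. f i) = (\<Sum>i\<in>A. f i) + (\<Sum>i\<in>B. f i)"
  using assms by (metis finite sum.union_disjoint)

lemma feasible_symmetric:
  assumes "LP2_feasible X"
  shows "X $ i $ j = X $ j $ i"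
proof -
  have "X $ i $ j = transpose X $ j $ i" by (simp add: transpose_def)
  also have "transpose X = X" using assms by (simp add: LP2_feasible_def)
  finally show ?thesis .
qed

text \<open>
  The Lagrangian identity behind weak duality, obtained by adding \<open>weighted_slack_sum\<close> for the two
  clusters. The condition \<open>q * e = p * e'\<close> gives the diagonal entries of both clusters the same
  coefficient, so the diagonal enters only through the trace. The condition \<open>r * q = s * p\<close> makes the
  distance sums of \<open>i\<close> and \<open>k\<close> to the opposite clusters cancel in the coefficient of \<open>X\<^sub>i\<^sub>k\<close>, and
  \<open>r + s = 2\<close> produces \<open>2 * d i k\<close> there. The last summand does not depend on \<open>X\<close>.
\<close>

lemma objective_decomposition:
  fixes X :: "real ^ ('n::{finite,linorder}) ^ ('n::{finite,linorder})" and d :: "'n \<Rightarrow> 'n \<Rightarrow> real"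
  assumes d: "\<And>i j. d i j = d j i"
    and part: "A \<inter> B = {}" "A \<union> B = UNIV"
    and ne: "A \<noteq> {}" "B \<noteq> {}"
  defines "p \<equiv> real (card A)" and "q \<equiv> real (card B)"
  assumes r: "r * q = s * p" "r + s = 2"
    and e: "q * e = p * e'"
    and X: "LP2_feasible X"
  shows "LP2_objective d X =
      (\<Sum>i\<in>A. \<Sum>j\<in>A. \<Sum>k\<in>B. multiplier d A B s e' i j k * triangle_slack X i j k)
    + (\<Sum>i\<in>B. \<Sum>j\<in>B. \<Sum>k\<in>A. multiplier d B A r e i j k * triangle_slack X i j k)
    + (\<Sum>i\<in>A. \<Sum>k\<in>B. X $ i $ k *
        (e + e' - ((1 - p / q) * d_in d A i + (1 - q / p) * d_in d B k
            + (\<Sum>j\<in>A. d_in d A j) / q + (\<Sum>j\<in>B. d_in d B j) / p)))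
    + ((\<Sum>i\<in>A. s / q * (\<Sum>k\<in>B. d i k) + d_in d A i - e')
      + (\<Sum>i\<in>B. r / p * (\<Sum>k\<in>A. d i k) + d_in d B i - e)
      - 2 * (s / q * (\<Sum>i\<in>A. \<Sum>k\<in>B. d i k) - p * e'))"
    (is "_ = ?LA + ?LB + ?G + (?KA + ?KB - 2 * ?W)")
proof -
  have pq: "p > 0" "q > 0" using ne by (simp_all add: p_def q_def card_gt_0_iff)
  note sym = feasible_symmetric[OF X]
  have rowA: "(\<Sum>j\<in>A. X $ i $ j) + (\<Sum>k\<in>B. X $ i $ k) = 1" for i
    using X sum_partition[OF part, of "\<lambda>j. X $ i $ j"] by (simp add: LP2_feasible_def)
  have rowB: "(\<Sum>j\<in>B. X $ i $ j) + (\<Sum>k\<in>A. X $ i $ k) = 1" for i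
    using rowA[of i] by simp
  have tr: "(\<Sum>i\<in>A. X $ i $ i) + (\<Sum>i\<in>B. X $ i $ i) = 2"
    using X sum_partition[OF part, of "\<lambda>i. X $ i $ i"] by (simp add: LP2_feasible_def trace_def)
  have c: "r / p = s / q" using r(1) pq by (simp add: frac_eq_eq)
  have "s / q * p = r * q / q" by (simp add: r(1))
  with r(2) pq have c2: "s / q * p + s / q * q = 2" by simp
  define c where "c = s / q"
  have cpq: "c * (p + q) = 2" using c2 by (simp add: c_def distrib_left)
  define CA where "CA i k = c * ((\<Sum>l\<in>B. d i l) - (\<Sum>j\<in>A. d j k) + p * d i k)
            + d_in d A i - e' + ((\<Sum>j\<in>A. d_in d A j) - p * d_in d A i) / q" for i k
  define CB where "CB k i = c * ((\<Sum>l\<in>A. d k l) - (\<Sum>j\<in>B. d j i) + q * d k i)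
            + d_in d B k - e + ((\<Sum>j\<in>B. d_in d B j) - q * d_in d B k) / p" for i k
  let ?g = "\<lambda>i k. (1 - p / q) * d_in d A i + (1 - q / p) * d_in d B k
            + (\<Sum>j\<in>A. d_in d A j) / q + (\<Sum>j\<in>B. d_in d B j) / p"
  have LA: "?LA = ?W * (\<Sum>i\<in>A. X $ i $ i) + (\<Sum>i\<in>A. \<Sum>j\<in>A. d i j * X $ i $ j) - ?KA
      + (\<Sum>i\<in>A. \<Sum>k\<in>B. X $ i $ k * CA i k)"
    unfolding CA_def c_def p_def q_def
    by (rule weighted_slack_sum[OF d sym rowA ne])
  have "?LB = (r / p * (\<Sum>i\<in>B. \<Sum>k\<in>A. d i k) - q * e) * (\<Sum>i\<in>B. X $ i $ i)
      + (\<Sum>i\<in>B. \<Sum>j\<in>B. d i j * X $ i $ j) - ?KB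
      + (\<Sum>k\<in>B. \<Sum>i\<in>A. X $ k $ i * CB k i)"
    unfolding CB_def c_def c[symmetric] unfolding p_def q_def
    by (rule weighted_slack_sum[OF d sym rowB ne(2) ne(1)])
  moreover have "(\<Sum>i\<in>B. \<Sum>k\<in>A. d i k) = (\<Sum>i\<in>A. \<Sum>k\<in>B. d i k)"
    by (subst sum.swap) (simp add: d)
  moreover have "(\<Sum>k\<in>B. \<Sum>i\<in>A. X $ k $ i * CB k i) = (\<Sum>i\<in>A. \<Sum>k\<in>B. X $ i $ k * CB k i)"
    by (subst sum.swap) (simp add: sym)
  ultimately have LB: "?LB = ?W * (\<Sum>i\<in>B. X $ i $ i) + (\<Sum>i\<in>B. \<Sum>j\<in>B. d i j * X $ i $ j) - ?KB
      + (\<Sum>i\<in>A. \<Sum>k\<in>B. X $ i $ k * CB k i)"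
    by (simp add: c e)
  have W: "?W * (\<Sum>i\<in>A. X $ i $ i) + ?W * (\<Sum>i\<in>B. X $ i $ i) = 2 * ?W"
    using tr by (simp flip: distrib_left)
  have obj: "LP2_objective d X = (\<Sum>i\<in>A. \<Sum>j\<in>A. d i j * X $ i $ j) + (\<Sum>i\<in>B. \<Sum>j\<in>B. d i j * X $ i $ j)
     + (\<Sum>i\<in>A. \<Sum>k\<in>B. X $ i $ k * (2 * d i k))"
  proof -
    have "(\<Sum>i\<in>B. \<Sum>k\<in>A. d i k * X $ i $ k) = (\<Sum>i\<in>A. \<Sum>k\<in>B. d i k * X $ i $ k)"
      by (subst sum.swap) (simp add: d sym)
    then show ?thesis
      by (simp add: LP2_objective_def sum_partition[OF part] sum.distrib algebra_simps
          sum_distrib_left)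
  qed
  \<comment> \<open>Both clusters together give each entry between them its cost, up to the reduced cost.\<close>
  have cc: "CA i k + CB k i = 2 * d i k + ?g i k - (e + e')" for i k
  proof -
    have 1: "(\<Sum>j\<in>A. d j k) = (\<Sum>l\<in>A. d k l)" "(\<Sum>j\<in>B. d j i) = (\<Sum>l\<in>B. d i l)" "d k i = d i k"
      by (simp_all add: d)
    have 2: "c * (p * d i k) + c * (q * d i k) = 2 * d i k"
      using cpq by (metis distrib_left distrib_right mult.assoc)
    show ?thesis
      using 2 unfolding CA_def CB_def 1
      by (simp add: algebra_simps diff_divide_distrib)
  qed
  have "(\<Sum>i\<in>A. \<Sum>k\<in>B. X $ i $ k * CA i k) + (\<Sum>i\<in>A. \<Sum>k\<in>B. X $ i $ k * CB k i) + ?G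
     = (\<Sum>i\<in>A. \<Sum>k\<in>B. X $ i $ k * (2 * d i k))"
    unfolding sum.distrib[symmetric] distrib_left[symmetric] cc by simp
  with LA LB W obj show ?thesis by linarith
qed

lemma triangle_slack_nonneg:
  assumes "LP2_feasible X" "i \<noteq> j" "i \<noteq> k" "j \<noteq> k"
  shows "triangle_slack X i j k \<ge> 0"
proof -
  consider "j < k" | "k < j" using assms by fastforce
  then show ?thesis
  proof cases
    case 1 then show ?thesis using assms by (force simp: LP2_feasible_def triangle_slack_def)
  next
    case 2
    then have "X $ i $ k + X $ i $ j \<le> X $ i $ i + X $ k $ j"
      using assms by (simp add: LP2_feasible_def)
    then show ?thesis using feasible_symmetric[OF assms(1), of k j] by (simp add: triangle_slack_def)
  qed
qed

lemma triangle_slack_refl: "triangle_slack X i i k = 0"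
  by (simp add: triangle_slack_def)

section \<open>The partition matrix\<close>

definition partition_matrix :: "'n set \<Rightarrow> 'n set \<Rightarrow> real ^ 'n ^ 'n" where
  "partition_matrix A B = (1 / real (card A)) *\<^sub>R outer_prod (ind_vec A) (ind_vec A)
                    + (1 / real (card B)) *\<^sub>R outer_prod (ind_vec B) (ind_vec B)"

lemma partition_matrix_nth:
  "partition_matrix A B $ i $ j =
     indicator A i * indicator A j / real (card A) + indicator B i * indicator B j / real (card B)"
  by (simp add: partition_matrix_def outer_prod_def ind_vec_def)

lemma partition_matrix_feasible:
  fixes A B :: "('n::{finite,linorder}) set"
  assumes part: "A \<inter> B = {}" "A \<union> B = UNIV" and ne: "A \<noteq> {}" "B \<noteq> {}"
  shows "LP2_feasible (partition_matrix A B)"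
proof -
  have pq: "real (card A) > 0" "real (card B) > 0" using ne by (simp_all add: card_gt_0_iff)
  have mem: "i \<in> B \<longleftrightarrow> i \<notin> A" for i using part by blast
  have sums: "(\<Sum>i\<in>UNIV. indicator A i) = real (card A)" "(\<Sum>i\<in>UNIV. indicator B i) = real (card B)"
    by (simp_all add: indicator_def)
  have "transpose (partition_matrix A B) = partition_matrix A B"
    by (simp add: transpose_def vec_eq_iff partition_matrix_nth mult.commute)
  moreover have "trace (partition_matrix A B) = 2"
  proof -
    have idem: "indicator S i * indicator S i = (indicator S i :: real)" for S :: "'n set" and i
      by (simp add: indicator_def)
    have "trace (partition_matrix A B) = (\<Sum>i\<in>UNIV. indicator A i) / real (card A)
        + (\<Sum>i\<in>UNIV. indicator B i) / real (card B)"
      by (simp only: trace_def partition_matrix_nth idem sum.distrib sum_divide_distrib)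
    then show ?thesis using ne sums by simp
  qed
  moreover have "(\<Sum>j\<in>UNIV. partition_matrix A B $ i $ j) = 1" for i
  proof -
    have "(\<Sum>j\<in>UNIV. partition_matrix A B $ i $ j) =
        indicator A i * (\<Sum>j\<in>UNIV. indicator A j) / real (card A)
        + indicator B i * (\<Sum>j\<in>UNIV. indicator B j) / real (card B)"
      by (simp only: partition_matrix_nth sum.distrib sum_divide_distrib[symmetric] sum_distrib_left[symmetric])
    then show ?thesis using ne sums mem[of i] by (simp add: indicator_def)
  qed
  moreover have "partition_matrix A B $ i $ j + partition_matrix A B $ i $ k
      \<le> partition_matrix A B $ i $ i + partition_matrix A B $ j $ k" for i j k
    using pq mem by (auto simp: partition_matrix_nth indicator_def)
  moreover have "0 \<le> partition_matrix A B $ i $ j" for i j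
    by (simp add: partition_matrix_nth)
  ultimately show ?thesis by (simp add: LP2_feasible_def)
qed

text \<open>
  Put \<open>u\<^sub>i = X\<^sub>i\<^sub>i / 2\<close>. Adding and subtracting the equalities at the apices \<open>i\<close> and \<open>j\<close> gives
  \<open>X\<^sub>i\<^sub>j = u\<^sub>i + u\<^sub>j\<close> inside a cluster and \<open>X\<^sub>i\<^sub>k - u\<^sub>i = X\<^sub>j\<^sub>k - u\<^sub>j\<close> across. The latter, used from both
  sides, shows that \<open>X\<^sub>i\<^sub>k - u\<^sub>i - u\<^sub>k\<close> is one constant \<open>c\<close> for all entries between the clusters; for
  a cluster with a single point this is vacuous on its side. With the trace, which makes the \<open>u\<^sub>i\<close> sum
  to \<open>1\<close>, the row sums become linear equations for \<open>u\<close> and \<open>c\<close>.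
\<close>

lemma tight_triangles_imp_partition_matrix:
  fixes X :: "real ^ ('n::{finite,linorder}) ^ ('n::{finite,linorder})"
  assumes part: "A \<inter> B = {}" "A \<union> B = UNIV" and ne: "A \<noteq> {}" "B \<noteq> {}"
    and X: "LP2_feasible X"
    and tA: "\<And>i j k. i \<in> A \<Longrightarrow> j \<in> A \<Longrightarrow> k \<in> B \<Longrightarrow> triangle_slack X i j k = 0"
    and tB: "\<And>i j k. i \<in> B \<Longrightarrow> j \<in> B \<Longrightarrow> k \<in> A \<Longrightarrow> triangle_slack X i j k = 0"
  shows "X = partition_matrix A B"
proof -
  define p q where "p = real (card A)" and "q = real (card B)"
  have pq: "p > 0" "q > 0" using ne by (simp_all add: p_def q_def card_gt_0_iff)
  have mem: "i \<in> B \<longleftrightarrow> i \<notin> A" for i using part by blast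
  note sym = feasible_symmetric[OF X]
  define u where "u i = X $ i $ i / 2" for i
  obtain a b where ab: "a \<in> A" "b \<in> B" using ne by blast
  define c where "c = X $ a $ b - u a - u b"
  have AA: "X $ i $ j = u i + u j" "X $ i $ k - u i = X $ j $ k - u j"
    if "i \<in> A" "j \<in> A" "k \<in> B" for i j k
    using tA[OF that] tA[OF that(2,1,3)] sym[of i j]
    by (simp_all add: triangle_slack_def u_def field_simps)
  have BB: "X $ i $ j = u i + u j" "X $ i $ k - u i = X $ j $ k - u j"
    if "i \<in> B" "j \<in> B" "k \<in> A" for i j k
    using tB[OF that] tB[OF that(2,1,3)] sym[of i j]
    by (simp_all add: triangle_slack_def u_def field_simps)
  have AB: "X $ i $ k = u i + u k + c" if "i \<in> A" "k \<in> B" for i k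
    using AA(2)[OF that(1) ab(1) that(2)] BB(2)[OF that(2) ab(2) ab(1)] sym[of k a] sym[of b a]
    by (simp add: c_def)
  have U: "(\<Sum>i\<in>A. u i) + (\<Sum>i\<in>B. u i) = 1"
    using X sum_partition[OF part, of u]
    by (simp add: LP2_feasible_def trace_def u_def sum_divide_distrib[symmetric])
  have row: "(\<Sum>j\<in>A. X $ i $ j) + (\<Sum>k\<in>B. X $ i $ k) = 1" for i
    using X sum_partition[OF part, of "\<lambda>j. X $ i $ j"] by (simp add: LP2_feasible_def)
  have uA: "(p + q) * u i = - q * c" if "i \<in> A" for i
  proof -
    have "(\<Sum>j\<in>A. X $ i $ j) = p * u i + (\<Sum>j\<in>A. u j)"
      using AA(1)[OF that _ ab(2)] by (simp add: sum.distrib p_def)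
    moreover have "(\<Sum>k\<in>B. X $ i $ k) = q * u i + (\<Sum>k\<in>B. u k) + q * c"
      using AB[OF that] by (simp add: sum.distrib q_def)
    ultimately show ?thesis using row[of i] U by (simp add: algebra_simps)
  qed
  have uB: "(p + q) * u i = - p * c" if "i \<in> B" for i
  proof -
    have "(\<Sum>j\<in>B. X $ i $ j) = q * u i + (\<Sum>j\<in>B. u j)"
      using BB(1)[OF that _ ab(1)] by (simp add: sum.distrib q_def)
    moreover have "(\<Sum>k\<in>A. X $ i $ k) = p * u i + (\<Sum>k\<in>A. u k) + p * c"
      using AB[OF _ that] sym[of i] by (simp add: sum.distrib p_def)
    ultimately show ?thesis using row[of i] U by (simp add: algebra_simps)
  qed
  \<comment> \<open>Summing the row equations determines \<open>c\<close>, and then the equations themselves determine \<open>u\<close>.\<close>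
  have "p + q = (\<Sum>i\<in>A. (p + q) * u i) + (\<Sum>i\<in>B. (p + q) * u i)"
    using U by (simp flip: sum_distrib_left distrib_left)
  also have "\<dots> = - 2 * p * q * c"
    using uA uB by (simp add: p_def q_def)
  finally have c: "p + q = - 2 * p * q * c" .
  have uA': "u i = 1 / (2 * p)" if "i \<in> A" for i
  proof -
    have "(p + q) * (2 * p * u i) = p + q" 
      using arg_cong[OF uA[OF that], of "\<lambda>t. 2 * p * t"] c by (simp add: algebra_simps)
    then have "2 * p * u i = 1" using pq by (simp only: mult_cancel_left2) simp
    then show ?thesis using pq by (simp add: field_simps)
  qed
  have uB': "u i = 1 / (2 * q)" if "i \<in> B" for i
  proof -
    have "(p + q) * (2 * q * u i) = p + q" 
      using arg_cong[OF uB[OF that], of "\<lambda>t. 2 * q * t"] c by (simp add: algebra_simps)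
    then have "2 * q * u i = 1" using pq by (simp only: mult_cancel_left2) simp
    then show ?thesis using pq by (simp add: field_simps)
  qed
  have c': "1 / (2 * p) + 1 / (2 * q) + c = 0"
    using c pq by (simp add: field_simps)
  have "X $ i $ j = partition_matrix A B $ i $ j" for i j
  proof (cases "i \<in> A"; cases "j \<in> A")
    assume "i \<in> A" "j \<in> A"
    then show ?thesis
      using AA(1)[of i j b] ab uA' mem by (simp add: partition_matrix_nth p_def indicator_def)
  next
    assume "i \<in> A" "j \<notin> A"
    then show ?thesis
      using AB[of i j] uA' uB' mem c' by (simp add: partition_matrix_nth indicator_def)
  next
    assume "i \<notin> A" "j \<in> A"
    then show ?thesis
      using AB[of j i] uA' uB' mem c' sym[of i j] by (simp add: partition_matrix_nth indicator_def)
  next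
    assume "i \<notin> A" "j \<notin> A"
    then show ?thesis
      using BB(1)[of i j a] ab uB' mem by (simp add: partition_matrix_nth q_def indicator_def)
  qed
  then show ?thesis by (simp add: vec_eq_iff)
qed

section \<open>Complementary slackness and the theorem\<close>

text \<open>
  Positive multipliers turn the weighted sum into a sum of nonnegative terms, so it vanishes only if
  every slack does. Positivity is available only for \<open>i \<noteq> j\<close>; for \<open>i = j\<close> the slack vanishes
  identically.
\<close>

lemma weighted_slack_sum_nonneg_tight:
  fixes A B :: "('n::{finite,linorder}) set"
  assumes X: "LP2_feasible X" and disj: "A \<inter> B = {}" and ne: "B \<noteq> {}"
    and gap: "\<And>i j. i \<in> A \<Longrightarrow> j \<in> A \<Longrightarrow> i \<noteq> j \<Longrightarrow> pair_gap d A B r e i j > 0"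
  shows "(\<Sum>i\<in>A. \<Sum>j\<in>A. \<Sum>k\<in>B. multiplier d A B r e i j k * triangle_slack X i j k) \<ge> 0"
    and "(\<Sum>i\<in>A. \<Sum>j\<in>A. \<Sum>k\<in>B. multiplier d A B r e i j k * triangle_slack X i j k) = 0 \<Longrightarrow>
      i \<in> A \<Longrightarrow> j \<in> A \<Longrightarrow> k \<in> B \<Longrightarrow> triangle_slack X i j k = 0"
proof -
  let ?t = "\<lambda>i j k. multiplier d A B r e i j k * triangle_slack X i j k"
  have pos: "multiplier d A B r e i j k > 0" if "i \<in> A" "j \<in> A" "i \<noteq> j" for i j k
    using gap[OF that] ne by (simp add: multiplier_pos)
  have nonneg: "?t i j k \<ge> 0" if "i \<in> A" "j \<in> A" "k \<in> B" for i j k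
  proof (cases "i = j")
    case False
    moreover have "i \<noteq> k" "j \<noteq> k" using that disj by auto
    ultimately show ?thesis
      using pos[OF that(1,2) False] triangle_slack_nonneg[OF X]
      by (intro mult_nonneg_nonneg) (simp_all add: less_imp_le)
  qed (simp add: triangle_slack_refl)
  then show "(\<Sum>i\<in>A. \<Sum>j\<in>A. \<Sum>k\<in>B. ?t i j k) \<ge> 0"
    by (intro sum_nonneg)
  assume 0: "(\<Sum>i\<in>A. \<Sum>j\<in>A. \<Sum>k\<in>B. ?t i j k) = 0" and i: "i \<in> A" and j: "j \<in> A" and k: "k \<in> B"
  have "(\<Sum>j\<in>A. \<Sum>k\<in>B. ?t i j k) = 0"
    using 0 i nonneg by (simp add: sum_nonneg_eq_0_iff sum_nonneg)
  then have "(\<Sum>k\<in>B. ?t i j k) = 0"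
    using i j nonneg by (simp add: sum_nonneg_eq_0_iff sum_nonneg)
  then have "?t i j k = 0"
    using i j k nonneg by (simp add: sum_nonneg_eq_0_iff)
  then show "triangle_slack X i j k = 0"
    using pos[OF i j, of k] by (cases "i = j") (simp_all add: triangle_slack_refl)
qed

theorem proposition3:
  fixes x :: "'n::{finite,linorder} \<Rightarrow> real ^ 'm"
    and d :: "'n \<Rightarrow> 'n \<Rightarrow> real"
    and \<Gamma>\<^sub>1 \<Gamma>\<^sub>2 :: "'n set"
    and r\<^sub>1 r\<^sub>2 \<eta> :: real
    and Xbar :: "real ^ ('n::{finite,linorder}) ^ ('n::{finite,linorder})"
  assumes d: "\<And>i j. d i j = (norm (x i - x j))\<^sup>2"
    and nonempty: "\<Gamma>\<^sub>1 \<noteq> {}" "\<Gamma>\<^sub>2 \<noteq> {}"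
    and disjoint: "\<Gamma>\<^sub>1 \<inter> \<Gamma>\<^sub>2 = {}"
    and covers: "\<Gamma>\<^sub>1 \<union> \<Gamma>\<^sub>2 = UNIV"
    and le: "card \<Gamma>\<^sub>1 \<le> card \<Gamma>\<^sub>2"
    and r1: "r\<^sub>1 = 2 * real (card \<Gamma>\<^sub>1) / (real (card \<Gamma>\<^sub>1) + real (card \<Gamma>\<^sub>2))"
    and r2: "r\<^sub>2 = 2 * real (card \<Gamma>\<^sub>2) / (real (card \<Gamma>\<^sub>1) + real (card \<Gamma>\<^sub>2))"
    and eta: "\<eta> = r\<^sub>2 / 2 *
        ((1 - r\<^sub>1 / r\<^sub>2) * Max (d_in d \<Gamma>\<^sub>1 ` \<Gamma>\<^sub>1)
         + (1 - r\<^sub>2 / r\<^sub>1) * Min (d_in d \<Gamma>\<^sub>2 ` \<Gamma>\<^sub>2)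
         + r\<^sub>1 / r\<^sub>2 * (1 / real (card \<Gamma>\<^sub>1)) * (\<Sum>k\<in>\<Gamma>\<^sub>1. d_in d \<Gamma>\<^sub>1 k)
         + r\<^sub>2 / r\<^sub>1 * (1 / real (card \<Gamma>\<^sub>2)) * (\<Sum>k\<in>\<Gamma>\<^sub>2. d_in d \<Gamma>\<^sub>2 k))"
    and ineq1: "\<And>i j. i \<in> \<Gamma>\<^sub>1 \<Longrightarrow> j \<in> \<Gamma>\<^sub>1 \<Longrightarrow> i < j \<Longrightarrow>
        1 / real (card \<Gamma>\<^sub>2) *
          (\<Sum>k\<in>\<Gamma>\<^sub>2. min (r\<^sub>2 * d i k + d_in d \<Gamma>\<^sub>1 j) (r\<^sub>2 * d j k + d_in d \<Gamma>\<^sub>1 i)) - d i j > \<eta>"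
    and ineq2: "\<And>i j. i \<in> \<Gamma>\<^sub>2 \<Longrightarrow> j \<in> \<Gamma>\<^sub>2 \<Longrightarrow> i < j \<Longrightarrow>
        1 / real (card \<Gamma>\<^sub>1) *
          (\<Sum>k\<in>\<Gamma>\<^sub>1. min (r\<^sub>1 * d i k + d_in d \<Gamma>\<^sub>2 j) (r\<^sub>1 * d j k + d_in d \<Gamma>\<^sub>2 i)) - d i j
          > r\<^sub>1 / r\<^sub>2 * \<eta>"
    and Xbar: "Xbar = (1 / real (card \<Gamma>\<^sub>1)) *\<^sub>R outer_prod (ind_vec \<Gamma>\<^sub>1) (ind_vec \<Gamma>\<^sub>1)
                    + (1 / real (card \<Gamma>\<^sub>2)) *\<^sub>R outer_prod (ind_vec \<Gamma>\<^sub>2) (ind_vec \<Gamma>\<^sub>2)"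
  shows "LP2_optimal d Xbar \<and> (\<forall>Y. LP2_optimal d Y \<longrightarrow> Y = Xbar)"
proof -
  define p q where "p = real (card \<Gamma>\<^sub>1)" and "q = real (card \<Gamma>\<^sub>2)"
  define e where "e = r\<^sub>1 / r\<^sub>2 * \<eta>"
  have pq: "p > 0" "q > 0" using nonempty by (simp_all add: p_def q_def card_gt_0_iff)
  have le': "p \<le> q" using le by (simp add: p_def q_def)
  have r1': "r\<^sub>1 = 2 * p / (p + q)" and r2': "r\<^sub>2 = 2 * q / (p + q)"
    using r1 r2 by (simp_all add: p_def q_def)
  have r12: "r\<^sub>1 / r\<^sub>2 = p / q" "r\<^sub>2 / r\<^sub>1 = q / p"
    using pq by (simp_all add: r1' r2')
  have sym: "d i j = d j i" for i j
    by (simp add: d norm_minus_commute)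
  have xbar: "Xbar = partition_matrix \<Gamma>\<^sub>1 \<Gamma>\<^sub>2"
    by (simp add: Xbar partition_matrix_def)
  have feas: "LP2_feasible Xbar"
    unfolding xbar by (rule partition_matrix_feasible[OF disjoint covers nonempty])
  have gap1: "pair_gap d \<Gamma>\<^sub>1 \<Gamma>\<^sub>2 r\<^sub>2 \<eta> i j > 0" if "i \<in> \<Gamma>\<^sub>1" "j \<in> \<Gamma>\<^sub>1" "i \<noteq> j" for i j
  proof -
    have "pair_gap d \<Gamma>\<^sub>1 \<Gamma>\<^sub>2 r\<^sub>2 \<eta> i j > 0" if "i \<in> \<Gamma>\<^sub>1" "j \<in> \<Gamma>\<^sub>1" "i < j" for i j
      using ineq1[OF that] by (simp add: pair_gap_def pair_min_def)
    then show ?thesis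
      using that pair_gap_commute[of d, OF sym] by (metis linorder_neqE)
  qed
  have gap2: "pair_gap d \<Gamma>\<^sub>2 \<Gamma>\<^sub>1 r\<^sub>1 e i j > 0" if "i \<in> \<Gamma>\<^sub>2" "j \<in> \<Gamma>\<^sub>2" "i \<noteq> j" for i j
  proof -
    have "pair_gap d \<Gamma>\<^sub>2 \<Gamma>\<^sub>1 r\<^sub>1 e i j > 0" if "i \<in> \<Gamma>\<^sub>2" "j \<in> \<Gamma>\<^sub>2" "i < j" for i j
      using ineq2[OF that] by (simp add: pair_gap_def pair_min_def e_def)
    then show ?thesis
      using that pair_gap_commute[of d, OF sym] by (metis linorder_neqE)
  qed
  have disjoint': "\<Gamma>\<^sub>2 \<inter> \<Gamma>\<^sub>1 = {}" using disjoint by blast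
  define g where "g i k = (1 - p / q) * d_in d \<Gamma>\<^sub>1 i + (1 - q / p) * d_in d \<Gamma>\<^sub>2 k
      + (\<Sum>j\<in>\<Gamma>\<^sub>1. d_in d \<Gamma>\<^sub>1 j) / q + (\<Sum>j\<in>\<Gamma>\<^sub>2. d_in d \<Gamma>\<^sub>2 j) / p" for i k
  \<comment> \<open>The choice of \<open>\<eta>\<close>: as \<open>p \<le> q\<close>, its first coefficient is \<open>\<ge> 0\<close> and its second \<open>\<le> 0\<close>, so \<open>g\<close> is bounded
      using the maximum over \<open>\<Gamma>\<^sub>1\<close> and the minimum over \<open>\<Gamma>\<^sub>2\<close>.\<close>
  have g: "g i k \<le> e + \<eta>" if "i \<in> \<Gamma>\<^sub>1" "k \<in> \<Gamma>\<^sub>2" for i k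
  proof -
    have 1: "(1 - p / q) * d_in d \<Gamma>\<^sub>1 i \<le> (1 - p / q) * Max (d_in d \<Gamma>\<^sub>1 ` \<Gamma>\<^sub>1)"
      using that pq le' by (intro mult_left_mono Max_ge) auto
    have 2: "(1 - q / p) * d_in d \<Gamma>\<^sub>2 k \<le> (1 - q / p) * Min (d_in d \<Gamma>\<^sub>2 ` \<Gamma>\<^sub>2)"
      using that pq le' by (intro mult_left_mono_neg Min_le) auto
    have "e + \<eta> = (p + q) / q * \<eta>"
      using pq by (simp add: e_def r12 field_simps)
    also have "\<dots> = (1 - p / q) * Max (d_in d \<Gamma>\<^sub>1 ` \<Gamma>\<^sub>1) + (1 - q / p) * Min (d_in d \<Gamma>\<^sub>2 ` \<Gamma>\<^sub>2)
      + (\<Sum>j\<in>\<Gamma>\<^sub>1. d_in d \<Gamma>\<^sub>1 j) / q + (\<Sum>j\<in>\<Gamma>\<^sub>2. d_in d \<Gamma>\<^sub>2 j) / p"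
    proof -
      have "(p + q) / q * (r\<^sub>2 / 2) = 1" using pq by (simp add: r2')
      then have "(p + q) / q * (r\<^sub>2 / 2 * z) = z" for z
        by (metis mult.assoc mult_1)
      then show ?thesis
        unfolding eta r12 p_def[symmetric] q_def[symmetric] using pq by simp
    qed
    finally show ?thesis using 1 2 by (simp add: g_def)
  qed
  define L1 where "L1 X = (\<Sum>i\<in>\<Gamma>\<^sub>1. \<Sum>j\<in>\<Gamma>\<^sub>1. \<Sum>k\<in>\<Gamma>\<^sub>2.
      multiplier d \<Gamma>\<^sub>1 \<Gamma>\<^sub>2 r\<^sub>2 \<eta> i j k * triangle_slack X i j k)" for X
  define L2 where "L2 X = (\<Sum>i\<in>\<Gamma>\<^sub>2. \<Sum>j\<in>\<Gamma>\<^sub>2. \<Sum>k\<in>\<Gamma>\<^sub>1.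
      multiplier d \<Gamma>\<^sub>2 \<Gamma>\<^sub>1 r\<^sub>1 e i j k * triangle_slack X i j k)" for X
  define G where "G X = (\<Sum>i\<in>\<Gamma>\<^sub>1. \<Sum>k\<in>\<Gamma>\<^sub>2. X $ i $ k * (e + \<eta> - g i k))" for X
  obtain K where obj: "LP2_objective d X = L1 X + L2 X + G X + K" if "LP2_feasible X" for X
  proof -
    have "r\<^sub>1 + r\<^sub>2 = 2 * (p + q) / (p + q)"
      by (simp only: r1' r2' add_divide_distrib distrib_left)
    also have "\<dots> = 2" using pq by (intro nonzero_mult_div_cancel_right) simp
    finally have 1: "r\<^sub>1 * q = r\<^sub>2 * p" "r\<^sub>1 + r\<^sub>2 = 2" "q * e = p * \<eta>"
      using pq by (simp_all add: r1' r2' e_def r12)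
    show ?thesis
      by (rule that, unfold L1_def L2_def G_def g_def p_def q_def)
        (rule objective_decomposition[OF sym disjoint covers nonempty 1[unfolded p_def q_def]])
  qed
  have L1: "L1 X \<ge> 0" if "LP2_feasible X" for X
    unfolding L1_def by (rule weighted_slack_sum_nonneg_tight(1)[OF that disjoint nonempty(2) gap1])
  have L2: "L2 X \<ge> 0" if "LP2_feasible X" for X
    unfolding L2_def by (rule weighted_slack_sum_nonneg_tight(1)[OF that disjoint' nonempty(1) gap2])
  have cross: "X $ i $ k \<ge> 0" if "LP2_feasible X" "i \<in> \<Gamma>\<^sub>1" "k \<in> \<Gamma>\<^sub>2" for X i k
  proof -
    have "i \<noteq> k" using that disjoint by blast
    then show ?thesis
      using that(1) feasible_symmetric[OF that(1), of i k]
      by (metis LP2_feasible_def linorder_neqE)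
  qed
  have G: "G X \<ge> 0" if "LP2_feasible X" for X
    unfolding G_def using cross[OF that] g by (intro sum_nonneg mult_nonneg_nonneg) simp_all
  have mem: "i \<in> \<Gamma>\<^sub>2 \<longleftrightarrow> i \<notin> \<Gamma>\<^sub>1" for i using disjoint covers by blast
  have "L1 Xbar = 0" "L2 Xbar = 0" "G Xbar = 0"
    unfolding L1_def L2_def G_def xbar using mem
    by (auto intro!: sum.neutral simp: triangle_slack_def partition_matrix_nth indicator_def)
  then have K: "LP2_objective d Xbar = K" using obj[OF feas] by simp
  have min: "K \<le> LP2_objective d X" if "LP2_feasible X" for X
    using obj[OF that] L1[OF that] L2[OF that] G[OF that] by simp
  have opt: "LP2_optimal d Xbar"
    using feas min K by (force simp: LP2_optimal_def is_arg_min_def)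
  moreover have "Y = Xbar" if "LP2_optimal d Y" for Y
  proof -
    have Y: "LP2_feasible Y" and "LP2_objective d Y = K"
      using that feas min K by (fastforce simp: LP2_optimal_def is_arg_min_def)+
    then have "L1 Y = 0" "L2 Y = 0"
      using obj[OF Y] L1[OF Y] L2[OF Y] G[OF Y] by simp_all
    then show ?thesis
      unfolding xbar L1_def L2_def
      using weighted_slack_sum_nonneg_tight(2)[OF Y disjoint nonempty(2) gap1]
        weighted_slack_sum_nonneg_tight(2)[OF Y disjoint' nonempty(1) gap2]
      by (intro tight_triangles_imp_partition_matrix[OF disjoint covers nonempty Y]) blast+
  qed
  ultimately show ?thesis by blast
qed

end
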